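(* Let $d$ be a constant and $f:\mathbb{F}_2^d\to\mathbb{F}_2$ with $\mathrm{pdeg}(f)=p<d$. Define $f^1=f$ and $f^{i+1}(x_1,\dots,x_{d^{i+1}})=f\big(f^i(x_1,\dots,x_{d^i}),\dots,f^i(x_{(d-1)d^i+1},\dots,x_{d^{i+1}})\big)$. For $u\ge1$ let $n=d^u$ and $g^u=f^u\oplus x_1\oplus\cdots\oplus x_n$. Then $g^u$ is $\big(n-n^{\frac{\log p}{\log d}}-1\big)$-resilient and there is a Boolean circuit computing $g^u$ of size $O(n)$ and depth $O(\log n)$.
   Context: $\mathrm{pdeg}$ is the real polynomial degree (degree of the unique multilinear real polynomial agreeing with the function on the Boolean cube). The Walsh transform is $W_h(\mathbf{u})=\sum_{\mathbf{x}}(-1)^{h(\mathbf{x})\oplus\mathbf{u}\cdot\mathbf{x}}$; $h$ is $m$-resilient if $W_h(\mathbf{u})=0$ for all $\mathbf{u}$ of Hamming weight at most $m$. *)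

theory Defs
  imports Complex_Main "HOL-Library.Z2" "HOL-Library.Landau_Symbols"
begin

text \<open>
  \<open>F\<^sub>2\<close> is the field \<^typ>\<open>bit\<close>; a vector in \<open>F\<^sub>2^n\<close> is a list of length \<open>n\<close>, and the
  coordinate \<open>x\<^sub>i\<close> is the list entry with index \<open>i - 1\<close>. A function \<open>F\<^sub>2^n \<rightarrow> F\<^sub>2\<close> is a
  function on lists, of which only the values on \<open>cube n\<close> matter.
\<close>

definition cube :: "nat \<Rightarrow> bit list set" where
  "cube n = {xs. length xs = n}"

subsection \<open>Real polynomial degree\<close>

text \<open>
  A multilinear real polynomial in \<open>n\<close> variables is given by its coefficients:
  \<open>c S\<close> is the coefficient of the monomial that is the product of the variables indexed by \<open>S\<close>.
\<close>

definition mpoly_eval :: "nat \<Rightarrow> (nat set \<Rightarrow> real) \<Rightarrow> (nat \<Rightarrow> real) \<Rightarrow> real" where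
  "mpoly_eval n c y = (\<Sum>S\<in>Pow {..<n}. c S * (\<Prod>i\<in>S. y i))"

definition represents :: "nat \<Rightarrow> (nat set \<Rightarrow> real) \<Rightarrow> (bit list \<Rightarrow> bit) \<Rightarrow> bool" where
  "represents n c h \<longleftrightarrow>
     (\<forall>S. \<not> S \<subseteq> {..<n} \<longrightarrow> c S = 0) \<and>
     (\<forall>xs\<in>cube n. mpoly_eval n c (\<lambda>i. of_bit (xs ! i)) = of_bit (h xs))"

lemma represents_iff:
  "represents n c h \<longleftrightarrow>
     (\<forall>S. \<not> S \<subseteq> {..<n} \<longrightarrow> c S = 0) \<and>
     (\<forall>T\<subseteq>{..<n}. (\<Sum>S\<in>Pow T. c S) = of_bit (h (map (\<lambda>i. of_bool (i \<in> T)) [0..<n])))"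
proof -
  define chi where "chi T = map (\<lambda>i. of_bool (i \<in> T) :: bit) [0..<n]" for T
  have cube: "cube n = chi ` Pow {..<n}"
  proof (intro equalityI subsetI)
    fix xs assume xs: "xs \<in> cube n"
    have "xs = chi {i. i < n \<and> odd (xs ! i)}"
    proof (rule nth_equalityI)
      fix i assume "i < length xs"
      then show "xs ! i = chi {i. i < n \<and> odd (xs ! i)} ! i"
        using xs by (cases "xs ! i") (auto simp: chi_def cube_def)
    qed (use xs in \<open>auto simp: chi_def cube_def\<close>)
    then show "xs \<in> chi ` Pow {..<n}" by blast
  qed (auto simp: chi_def cube_def)
  have ev: "mpoly_eval n c (\<lambda>i. of_bit (chi T ! i)) = (\<Sum>S\<in>Pow T. c S)"
    if T: "T \<subseteq> {..<n}" for T
  proof -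
    have "(\<Prod>i\<in>S. of_bit (chi T ! i) :: real) = of_bool (S \<subseteq> T)" if S: "S \<subseteq> {..<n}" for S
    proof -
      have fin: "finite S" using S finite_subset by blast
      have "(\<Prod>i\<in>S. of_bit (chi T ! i) :: real) = (\<Prod>i\<in>S. of_bool (i \<in> T))"
        using S by (intro prod.cong) (auto simp: chi_def)
      also have "\<dots> = of_bool (S \<subseteq> T)"
        using fin by (cases "S \<subseteq> T") (auto intro!: prod.neutral)
      finally show ?thesis .
    qed
    then have "mpoly_eval n c (\<lambda>i. of_bit (chi T ! i)) =
        (\<Sum>S\<in>Pow {..<n}. c S * of_bool (S \<subseteq> T))"
      unfolding mpoly_eval_def by (intro sum.cong) auto
    also have "\<dots> = (\<Sum>S\<in>Pow T. c S)"
      using T by (intro sum.mono_neutral_cong_right) auto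
    finally show ?thesis .
  qed
  have "(\<forall>xs\<in>cube n. mpoly_eval n c (\<lambda>i. of_bit (xs ! i)) = of_bit (h xs)) \<longleftrightarrow>
        (\<forall>T\<subseteq>{..<n}. (\<Sum>S\<in>Pow T. c S) = of_bit (h (chi T)))"
    unfolding cube using ev by (auto simp del: of_bool_eq_iff)
  then show ?thesis unfolding represents_def chi_def by simp
qed

lemma represents_unique_existence: "\<exists>!c. represents n c h"
proof -
  define F where "F T = (of_bit (h (map (\<lambda>i. of_bool (i \<in> T)) [0..<n])) :: real)" for T
  define g where "g S = (\<Sum>T\<in>Pow S. (-1) ^ card T * F T)" for S
  define c where "c S = (if S \<subseteq> {..<n} then (-1) ^ card S * g S else 0)" for S
  have "represents n c h"
    unfolding represents_iff
  proof (intro conjI allI impI)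
    fix T assume T: "T \<subseteq> {..<n}"
    then have "(\<Sum>S\<in>Pow T. c S) = (\<Sum>S\<in>Pow T. (-1) ^ card S * g S)"
      by (intro sum.cong) (auto simp: c_def)
    also have "\<dots> = F T"
      by (rule inclusion_exclusion_symmetric[symmetric])
        (use T finite_subset in \<open>auto simp: g_def\<close>)
    finally show "(\<Sum>S\<in>Pow T. c S) = of_bit (h (map (\<lambda>i. of_bool (i \<in> T)) [0..<n]))"
      by (simp only: F_def)
  qed (simp add: c_def)
  moreover have "c1 = c2" if c1: "represents n c1 h" and c2: "represents n c2 h" for c1 c2
  proof
    fix S
    show "c1 S = c2 S"
    proof (cases "S \<subseteq> {..<n}")
      case True
      then have "finite S" using finite_subset by blast
      then show ?thesis using True
      proof (induction S rule: finite_psubset_induct)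
        case (psubset S)
        have "(\<Sum>U\<in>Pow S. c1 U) = (\<Sum>U\<in>Pow S. c2 U)"
          using c1 c2 psubset.prems unfolding represents_iff by metis
        moreover have "(\<Sum>U\<in>Pow S - {S}. c1 U) = (\<Sum>U\<in>Pow S - {S}. c2 U)"
          using psubset by (intro sum.cong) auto
        ultimately show ?case
          using psubset.hyps by (simp add: sum.remove[of "Pow S" S])
      qed
    next
      case False
      then show ?thesis using c1 c2 unfolding represents_iff by metis
    qed
  qed
  ultimately show ?thesis by blast
qed

text \<open>The zero polynomial gets degree 0.\<close>

definition mpoly_degree :: "nat \<Rightarrow> (nat set \<Rightarrow> real) \<Rightarrow> nat" where
  "mpoly_degree n c = Max (insert 0 (card ` {S. S \<subseteq> {..<n} \<and> c S \<noteq> 0}))"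

definition pdeg :: "nat \<Rightarrow> (bit list \<Rightarrow> bit) \<Rightarrow> nat" where
  "pdeg n h = mpoly_degree n (THE c. represents n c h)"

subsection \<open>Walsh transform and resilience\<close>

definition walsh :: "nat \<Rightarrow> (bit list \<Rightarrow> bit) \<Rightarrow> bit list \<Rightarrow> int" where
  "walsh n h u = (\<Sum>x\<in>cube n. (- 1) ^ of_bit (h x + (\<Sum>i<n. u ! i * x ! i)))"

definition hamming_weight :: "bit list \<Rightarrow> nat" where
  "hamming_weight u = card {i. i < length u \<and> u ! i = 1}"

definition resilient :: "nat \<Rightarrow> nat \<Rightarrow> (bit list \<Rightarrow> bit) \<Rightarrow> bool" where
  "resilient m n h \<longleftrightarrow> (\<forall>u\<in>cube n. hamming_weight u \<le> m \<longrightarrow> walsh n h u = 0)"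

subsection \<open>Iterated composition\<close>

text \<open>The value at iteration index 0 is irrelevant; indices start at 1.\<close>

fun iter_comp :: "nat \<Rightarrow> (bit list \<Rightarrow> bit) \<Rightarrow> nat \<Rightarrow> bit list \<Rightarrow> bit" where
  "iter_comp d f 0 xs = xs ! 0"
| "iter_comp d f (Suc 0) xs = f xs"
| "iter_comp d f (Suc (Suc i)) xs =
     f (map (\<lambda>j. iter_comp d f (Suc i) (take (d ^ Suc i) (drop (j * d ^ Suc i) xs))) [0..<d])"

definition masked :: "nat \<Rightarrow> (bit list \<Rightarrow> bit) \<Rightarrow> nat \<Rightarrow> bit list \<Rightarrow> bit" where
  "masked d f u xs = iter_comp d f u xs + (\<Sum>i<d ^ u. xs ! i)"

text \<open>
  \<open>n^(log p / log d)\<close>, with the convention \<open>log 0 = -\<infinity>\<close> (so the value is 0) for \<open>p = 0\<close>,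
  i.e. for constant functions; HOL's \<open>ln 0 = 0\<close> would give 1 instead.
\<close>

definition pow_log_ratio :: "nat \<Rightarrow> nat \<Rightarrow> nat \<Rightarrow> real" where
  "pow_log_ratio n p d = (if p = 0 then 0 else real n powr (ln (real p) / ln (real d)))"

subsection \<open>Boolean circuits\<close>

text \<open>
  Circuits have gates of fan-in at most 2 and unbounded fan-out. In a circuit on \<open>n\<close> inputs, wires
  \<open>0, \<dots>, n - 1\<close> are the inputs and wire \<open>n + k\<close> is the output of the \<open>k\<close>-th gate, which may only
  read wires with smaller indices. Size is the number of gates; depth is the maximal number of
  gates on a path from an input to the output wire.
\<close>

datatype gate = Not_Gate nat | And_Gate nat nat | Or_Gate nat nat

datatype circuit = Circuit (gates: "gate list") (out_wire: nat)

fun gate_inputs :: "gate \<Rightarrow> nat set" where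
  "gate_inputs (Not_Gate i) = {i}"
| "gate_inputs (And_Gate i j) = {i, j}"
| "gate_inputs (Or_Gate i j) = {i, j}"

definition wf_circuit :: "nat \<Rightarrow> circuit \<Rightarrow> bool" where
  "wf_circuit n C \<longleftrightarrow>
     (\<forall>k<length (gates C). \<forall>i\<in>gate_inputs (gates C ! k). i < n + k) \<and>
     out_wire C < n + length (gates C)"

fun gate_value :: "bit list \<Rightarrow> gate \<Rightarrow> bit" where
  "gate_value v (Not_Gate i) = 1 + v ! i"
| "gate_value v (And_Gate i j) = v ! i * v ! j"
| "gate_value v (Or_Gate i j) = v ! i + v ! j + v ! i * v ! j"

definition circuit_value :: "circuit \<Rightarrow> bit list \<Rightarrow> bit" where
  "circuit_value C xs = foldl (\<lambda>v g. v @ [gate_value v g]) xs (gates C) ! out_wire C"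

definition computes :: "nat \<Rightarrow> circuit \<Rightarrow> (bit list \<Rightarrow> bit) \<Rightarrow> bool" where
  "computes n C h \<longleftrightarrow> wf_circuit n C \<and> (\<forall>xs\<in>cube n. circuit_value C xs = h xs)"

definition circuit_size :: "circuit \<Rightarrow> nat" where
  "circuit_size C = length (gates C)"

definition circuit_depth :: "nat \<Rightarrow> circuit \<Rightarrow> nat" where
  "circuit_depth n C =
     foldl (\<lambda>D g. D @ [Suc (Max ((!) D ` gate_inputs g))]) (replicate n 0) (gates C) ! out_wire C"

end

theory Submission
  imports Defs
begin

text \<open>
  Masking with the parity \<open>x\<^sub>1 \<oplus> \<dots> \<oplus> x\<^sub>n\<close> replaces the Walsh argument by its complement, and the Walsh
  transform of a function of real degree \<open>D\<close> vanishes at all arguments of weight above \<open>D\<close>. Real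
  degree is submultiplicative under composition, so \<open>f\<^sup>u\<close> has degree at most \<open>p\<^sup>u\<close>, which is
  \<open>n powr (log p / log d)\<close>. For the circuit, \<open>f\<^sup>u\<close> is a \<open>d\<close>-ary tree of copies of one fixed gadget, and
  so is the parity of \<open>d\<^sup>u\<close> bits: it is the \<open>u\<close>-fold iterate of the parity of \<open>d\<close> bits.
\<close>

section \<open>Real degree and the Walsh transform\<close>

text \<open>
  \<open>degree_le n D F\<close> is degree at most \<open>D\<close> on the cube, phrased through juntas instead of
  monomials: products and substitutions then need no multilinear reduction.
\<close>

inductive degree_le :: "nat \<Rightarrow> nat \<Rightarrow> (bit list \<Rightarrow> real) \<Rightarrow> bool" for n D where
  junta: "\<lbrakk>S \<subseteq> {..<n}; card S \<le> D;
    \<And>xs ys. \<lbrakk>xs \<in> cube n; ys \<in> cube n; \<And>i. i \<in> S \<Longrightarrow> xs ! i = ys ! i\<rbrakk> \<Longrightarrow> F xs = F ys\<rbrakk>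
    \<Longrightarrow> degree_le n D F"
| add: "\<lbrakk>degree_le n D F; degree_le n D G\<rbrakk> \<Longrightarrow> degree_le n D (\<lambda>xs. F xs + G xs)"

section \<open>Closure properties of the degree bound\<close>

lemma degree_le_const: "degree_le n D (\<lambda>_. a)"
  by (rule junta[of "{}"]) auto

lemma degree_le_mono:
  assumes "degree_le n D F" "D \<le> E"
  shows "degree_le n E F"
  using assms
proof (induction rule: degree_le.induct)
  case (junta S F)
  show ?case
    by (rule degree_le.junta[OF junta(1) _ junta(3)]) (use junta(2,4) in auto)
next
  case (add F G)
  then show ?case by (intro degree_le.add)
qed

text \<open>The junta rule compares arguments in the cube only, so \<open>G - F\<close>, which
  vanishes there, is a junta on the empty set; adding it to \<open>F\<close> gives
  \<open>G\<close>.\<close>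

lemma degree_le_cong:
  assumes "degree_le n D F" "\<And>xs. xs \<in> cube n \<Longrightarrow> G xs = F xs"
  shows "degree_le n D G"
proof -
  have "degree_le n D (\<lambda>xs. G xs - F xs)"
    by (rule junta[of "{}"]) (use assms(2) in auto)
  from add[OF assms(1) this] show ?thesis by simp
qed

text \<open>A product of two juntas is a junta on the union of their coordinate sets, and products
  distribute over the sums built by \<open>add\<close>. Hence a nested induction, one for each
  factor.\<close>

lemma degree_le_mult:
  assumes "degree_le n D F" "degree_le n E G"
  shows "degree_le n (D + E) (\<lambda>xs. F xs * G xs)"
  using assms(1)
proof (induction rule: degree_le.induct)
  case F: (junta S F)
  from assms(2) show ?case
  proof (induction rule: degree_le.induct)
    case (junta T G)
    show ?case
    proof (rule degree_le.junta[of "S \<union> T"])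
      show "card (S \<union> T) \<le> D + E"
        using card_Un_le[of S T] F(2) junta(2) by linarith
    next
      fix xs ys assume "xs \<in> cube n" "ys \<in> cube n" "\<And>i. i \<in> S \<union> T \<Longrightarrow> xs ! i = ys ! i"
      then show "F xs * G xs = F ys * G ys"
        using F(3)[of xs ys] junta(3)[of xs ys] by auto
    qed (use F(1) junta(1) in auto)
  next
    case (add G H)
    then show ?case unfolding distrib_left by (intro degree_le.add)
  qed
next
  case (add F G)
  then show ?case unfolding distrib_right by (intro degree_le.add)
qed

lemma degree_le_sum:
  assumes "\<And>k. k \<in> A \<Longrightarrow> degree_le n D (F k)"
  shows "degree_le n D (\<lambda>xs. \<Sum>k\<in>A. F k xs)"
  using assms
proof (induction A rule: infinite_finite_induct)
  case (insert k A)
  have "degree_le n D (\<lambda>xs. F k xs + (\<Sum>j\<in>A. F j xs))"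
    by (rule degree_le.add) (use insert in simp_all)
  then show ?case using insert.hyps by simp
qed (simp_all add: degree_le_const)

lemma degree_le_prod:
  assumes "finite A" "\<And>k. k \<in> A \<Longrightarrow> degree_le n D (F k)"
  shows "degree_le n (card A * D) (\<lambda>xs. \<Prod>k\<in>A. F k xs)"
  using assms
proof (induction A rule: finite_induct)
  case (insert k A)
  have "degree_le n (D + card A * D) (\<lambda>xs. F k xs * (\<Prod>j\<in>A. F j xs))"
    by (rule degree_le_mult) (use insert in simp_all)
  then show ?case using insert.hyps by simp
qed (simp add: degree_le_const)

text \<open>The coordinate sets of the juntas are shifted by \<open>a\<close>;
  \<open>a + m \<le> n\<close> keeps them in range and makes the block have full length
  \<open>m\<close>.\<close>

lemma degree_le_block:
  assumes "degree_le m D F" "a + m \<le> n"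
  shows "degree_le n D (\<lambda>xs. F (take m (drop a xs)))"
  using assms(1)
proof (induction rule: degree_le.induct)
  case (junta S F)
  have "card ((+) a ` S) = card S" by (intro card_image) auto
  show ?case
  proof (rule degree_le.junta[of "(+) a ` S"])
    fix xs ys :: "bit list"
    assume "xs \<in> cube n" "ys \<in> cube n" "\<And>i. i \<in> (+) a ` S \<Longrightarrow> xs ! i = ys ! i"
    then show "F (take m (drop a xs)) = F (take m (drop a ys))"
      using junta(1) assms(2) by (intro junta(3)) (auto simp: cube_def subset_eq)
  qed (use junta(1,2) \<open>card _ = _\<close> assms(2) in auto)
next
  case (add F G)
  then show ?case by (intro degree_le.add)
qed

section \<open>Degree under composition and iteration\<close>

lemma pdeg_polynomial:
  obtains c where "represents n c h" "\<And>S. S \<subseteq> {..<n} \<Longrightarrow> c S \<noteq> 0 \<Longrightarrow> card S \<le> pdeg n h"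
proof -
  define c where "c = (THE c. represents n c h)"
  have "represents n c h"
    unfolding c_def by (rule theI'[OF represents_unique_existence])
  moreover have "card S \<le> pdeg n h" if "S \<subseteq> {..<n}" "c S \<noteq> 0" for S
    unfolding pdeg_def mpoly_degree_def c_def[symmetric]
    by (rule Max_ge) (use that in auto)
  ultimately show thesis using that by blast
qed

text \<open>Substitute the inner functions into the multilinear polynomial of \<open>f\<close>: a
  monomial with nonzero coefficient is a product of at most \<open>pdeg d f\<close> factors, each of
  degree at most \<open>D\<close>.\<close>

lemma degree_le_compose:
  assumes "\<And>j. j < d \<Longrightarrow> degree_le n D (\<lambda>xs. of_bit (h j xs))"
  shows "degree_le n (pdeg d f * D) (\<lambda>xs. of_bit (f (map (\<lambda>j. h j xs) [0..<d])))"
proof -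
  obtain c where c: "represents d c f"
    and supp: "\<And>S. S \<subseteq> {..<d} \<Longrightarrow> c S \<noteq> 0 \<Longrightarrow> card S \<le> pdeg d f"
    using pdeg_polynomial by blast
  have "degree_le n (pdeg d f * D) (\<lambda>xs. \<Sum>S\<in>Pow {..<d}. c S * (\<Prod>j\<in>S. of_bit (h j xs)))"
  proof (rule degree_le_sum)
    fix S assume S: "S \<in> Pow {..<d}"
    show "degree_le n (pdeg d f * D) (\<lambda>xs. c S * (\<Prod>j\<in>S. of_bit (h j xs)))"
    proof (cases "c S = 0")
      case False
      have "degree_le n (card S * D) (\<lambda>xs. \<Prod>j\<in>S. of_bit (h j xs))"
        using S assms by (intro degree_le_prod) (auto intro: finite_subset)
      from degree_le_mult[OF degree_le_const[of n 0 "c S"] this]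
      show ?thesis
        by (rule degree_le_mono) (use supp[of S] S False in auto)
    qed (simp add: degree_le_const)
  qed
  then show ?thesis
  proof (rule degree_le_cong)
    fix xs
    let ?ys = "map (\<lambda>j. h j xs) [0..<d]"
    have "of_bit (f ?ys) = mpoly_eval d c (\<lambda>i. of_bit (?ys ! i))"
      using c by (auto simp: represents_def cube_def)
    also have "\<dots> = (\<Sum>S\<in>Pow {..<d}. c S * (\<Prod>j\<in>S. of_bit (h j xs)))"
      unfolding mpoly_eval_def
      by (intro sum.cong refl arg_cong2[where f = "(*)"] prod.cong) auto
    finally show "of_bit (f ?ys) = (\<Sum>S\<in>Pow {..<d}. c S * (\<Prod>j\<in>S. of_bit (h j xs)))" .
  qed
qed

text \<open>This lets inductions start at index 0. There the iterate is the projection to the first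
  entry, which on blocks of length 1 acts as the identity, so the uniform recursion also gives
  \<open>f\<close> at index 1.\<close>

lemma iter_comp_Suc:
  assumes "xs \<in> cube (d ^ Suc i)"
  shows "iter_comp d f (Suc i) xs =
    f (map (\<lambda>j. iter_comp d f i (take (d ^ i) (drop (j * d ^ i) xs))) [0..<d])"
proof (cases i)
  case 0
  have "xs = map (\<lambda>j. take 1 (drop j xs) ! 0) [0..<d]"
    using assms 0 by (intro nth_equalityI) (auto simp: cube_def)
  then show ?thesis using 0 by simp
qed simp

lemma block_le:
  fixes j d m :: nat
  assumes "j < d"
  shows "j * m + m \<le> d * m"
  using mult_le_mono1[of "Suc j" d m] assms by simp

lemma degree_le_iter_comp:
  "degree_le (d ^ i) (pdeg d f ^ i) (\<lambda>xs. of_bit (iter_comp d f i xs))"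
proof (induction i)
  case 0
  \<comment> \<open>The projection depends on one coordinate, and the bound is
    \<open>pdeg d f ^ 0 = 1\<close> even when \<open>pdeg d f = 0\<close>.\<close>
  show ?case by (rule junta[of "{0}"]) auto
next
  case (Suc i)
  have "degree_le (d ^ Suc i) (pdeg d f * pdeg d f ^ i) (\<lambda>xs. of_bit
      (f (map (\<lambda>j. iter_comp d f i (take (d ^ i) (drop (j * d ^ i) xs))) [0..<d])))"
    by (intro degree_le_compose degree_le_block[OF Suc.IH]) (simp add: block_le)
  then show ?case
    unfolding power_Suc[of "pdeg d f"]
    by (rule degree_le_cong) (simp only: iter_comp_Suc)
qed

section \<open>Orthogonality to characters of high weight, and resilience\<close>

lemma degree_le_orthogonal:
  assumes "degree_le n D F" "card {i. i < n \<and> v i = (1 :: bit)} > D"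
  shows "(\<Sum>x\<in>cube n. F x * (- 1) ^ of_bit (\<Sum>i<n. v i * x ! i)) = 0"
  using assms(1)
proof (induction rule: degree_le.induct)
  case (junta S F)
  have "\<not> {i. i < n \<and> v i = 1} \<subseteq> S"
  proof
    assume "{i. i < n \<and> v i = 1} \<subseteq> S"
    then have "card {i. i < n \<and> v i = 1} \<le> card S"
      by (rule card_mono[OF finite_subset[OF junta(1) finite_lessThan]])
    then show False using assms(2) junta(2) by linarith
  qed
  \<comment> \<open>The character has more coordinates than the junta, so it involves some
    \<open>k\<close> outside \<open>S\<close>. Flipping coordinate \<open>k\<close> is an involution
    of the cube that fixes \<open>F\<close> and negates the character, hence the sum equals its own
    negative.\<close>
  then obtain k where k: "k < n" "v k = 1" "k \<notin> S" by auto
  define flip where "flip x = x[k := x ! k + 1]" for x :: "bit list"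
  let ?s = "\<lambda>x. (- 1 :: real) ^ of_bit (\<Sum>i<n. v i * x ! i)"
  have flip_cube: "flip x \<in> cube n" if "x \<in> cube n" for x
    using that by (simp add: flip_def cube_def)
  have flip_flip: "flip (flip x) = x" if "x \<in> cube n" for x
    using that k by (cases "x ! k") (auto simp: flip_def cube_def list_update_same_conv)
  have F: "F (flip x) = F x" if "x \<in> cube n" for x
  proof (rule junta(3)[OF flip_cube[OF that] that])
    fix i assume "i \<in> S"
    then show "flip x ! i = x ! i"
      using k(3) unfolding flip_def by (intro nth_list_update_neq) auto
  qed
  have s: "?s (flip x) = - ?s x" if x: "x \<in> cube n" for x
  proof -
    have rest: "(\<Sum>i\<in>{..<n} - {k}. v i * flip x ! i) = (\<Sum>i\<in>{..<n} - {k}. v i * x ! i)"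
      by (intro sum.cong) (auto simp: flip_def)
    have split: "(\<Sum>i<n. g i) = g k + (\<Sum>i\<in>{..<n} - {k}. g i)" for g :: "nat \<Rightarrow> bit"
      by (rule sum.remove) (use k in auto)
    have "v k * flip x ! k = 1 + v k * x ! k"
      using k x by (simp add: flip_def cube_def)
    then have "(\<Sum>i<n. v i * flip x ! i) = 1 + (\<Sum>i<n. v i * x ! i)"
      by (simp only: split[of "\<lambda>i. v i * flip x ! i"] split[of "\<lambda>i. v i * x ! i"] rest add.assoc)
    then show ?thesis by (cases "\<Sum>i<n. v i * x ! i") auto
  qed
  have "(\<Sum>x\<in>cube n. F x * ?s x) = (\<Sum>x\<in>cube n. F (flip x) * ?s (flip x))"
    by (rule sum.reindex_bij_witness[of _ flip flip]) (auto simp: flip_cube flip_flip)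
  also have "\<dots> = - (\<Sum>x\<in>cube n. F x * ?s x)"
    unfolding sum_negf[symmetric]
    by (intro sum.cong refl) (simp only: F s mult_minus_right)
  finally show ?case by (simp only: equal_neg_zero)
next
  case (add F G)
  then show ?case by (simp add: distrib_right sum.distrib)
qed

lemma walsh_parity_add_eq_0:
  assumes deg: "degree_le n D (\<lambda>xs. of_bit (h xs))"
    and u: "u \<in> cube n" "hamming_weight u + D < n"
  shows "walsh n (\<lambda>xs. h xs + (\<Sum>i<n. xs ! i)) u = 0"
proof -
  \<comment> \<open>\<open>v\<close> is the complement of \<open>u\<close>. The two supports cover
    all \<open>n\<close> coordinates, so the weight of \<open>v\<close> is at least \<open>n\<close>
    minus that of \<open>u\<close>, which exceeds \<open>D\<close>.\<close>
  define v where "v i = 1 + u ! i" for i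
  have "card ({i. i < n \<and> v i = 1} \<union> {i. i < n \<and> u ! i = 1})
      \<le> card {i. i < n \<and> v i = 1} + hamming_weight u"
    using u(1) card_Un_le by (auto simp: hamming_weight_def cube_def)
  moreover have "{i. i < n \<and> v i = 1} \<union> {i. i < n \<and> u ! i = 1} = {..<n}"
    by (auto simp: v_def)
  ultimately have v: "card {i. i < n \<and> v i = 1} > D" using u(2) by simp
  \<comment> \<open>The sign is an affine function of the real value of \<open>h\<close>, so it
    inherits the degree bound \<open>D\<close>.\<close>
  have sign: "(- 1 :: real) ^ of_bit (h x) = 1 + (- 2) * of_bit (h x)" for x
    by (cases "h x") auto
  have deg': "degree_le n D (\<lambda>x. (- 1) ^ of_bit (h x))"
    unfolding sign
    using add[OF degree_le_const[of n D 1] degree_le_mult[OF degree_le_const[of n 0 "-2"] deg, simplified]]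
    by simp
  have "real_of_int (walsh n (\<lambda>xs. h xs + (\<Sum>i<n. xs ! i)) u)
      = (\<Sum>x\<in>cube n. (- 1) ^ of_bit (h x) * (- 1) ^ of_bit (\<Sum>i<n. v i * x ! i))"
    unfolding walsh_def of_int_sum
  proof (intro sum.cong refl)
    fix x :: "bit list"
    have "(\<Sum>i<n. x ! i) + (\<Sum>i<n. u ! i * x ! i) = (\<Sum>i<n. v i * x ! i)"
      by (simp only: v_def distrib_right sum.distrib mult_1_left)
    moreover have "(- 1 :: real) ^ of_bit (a + b) = (- 1) ^ of_bit a * (- 1) ^ of_bit b" for a b
      by (cases a; cases b) auto
    ultimately show "real_of_int ((- 1) ^ of_bit (h x + (\<Sum>i<n. x ! i) + (\<Sum>i<n. u ! i * x ! i)))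
        = (- 1) ^ of_bit (h x) * (- 1) ^ of_bit (\<Sum>i<n. v i * x ! i)"
      by (simp only: add.assoc of_int_power of_int_minus of_int_1)
  qed
  also have "\<dots> = 0" by (rule degree_le_orthogonal[OF deg' v])
  finally show ?thesis by simp
qed

lemma resilient_masked:
  assumes "m + pdeg d f ^ u < d ^ u"
  shows "resilient m (d ^ u) (masked d f u)"
  unfolding resilient_def masked_def
  by (intro ballI impI walsh_parity_add_eq_0[OF degree_le_iter_comp]) (use assms in auto)

text \<open>The identity \<open>d powr (ln p / ln d) = p\<close> is raised to the power
  \<open>u\<close>; \<open>2 \<le> d\<close> makes \<open>ln d\<close> nonzero. For
  \<open>p = 0\<close> the convention gives 0, which agrees with \<open>p ^ u\<close> because
  \<open>u \<ge> 1\<close>.\<close>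

lemma pow_log_ratio_eq:
  assumes "2 \<le> d" "1 \<le> u"
  shows "pow_log_ratio (d ^ u) p d = real (p ^ u)"
proof (cases "p = 0")
  case False
  have "real (d ^ u) powr (ln p / ln d) = (real d powr (ln p / ln d)) ^ u"
    using assms by (simp add: powr_powr mult.commute flip: powr_realpow)
  also have "real d powr (ln p / ln d) = p"
    using assms False by (simp add: powr_def)
  finally show ?thesis using False by (simp add: pow_log_ratio_def)
qed (use assms in \<open>simp add: pow_log_ratio_def\<close>)

section \<open>Circuits\<close>

abbreviation wire_values :: "bit list \<Rightarrow> gate list \<Rightarrow> bit list" where
  "wire_values \<equiv> foldl (\<lambda>v g. v @ [gate_value v g])"

abbreviation wire_depths :: "nat list \<Rightarrow> gate list \<Rightarrow> nat list" where
  "wire_depths \<equiv> foldl (\<lambda>D g. D @ [Suc (Max ((!) D ` gate_inputs g))])"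

lemma length_foldl_snoc:
  "length (foldl (\<lambda>v g. v @ [F v g]) xs gs) = length xs + length gs"
  by (induction gs rule: rev_induct) auto

text \<open>Appending gates never alters earlier wires. The step function \<open>F\<close> is left
  generic so that the fact serves both wire values and wire depths.\<close>

lemma foldl_snoc_append_nth:
  assumes "w < length xs + length gs"
  shows "foldl (\<lambda>v g. v @ [F v g]) xs (gs @ gs') ! w = foldl (\<lambda>v g. v @ [F v g]) xs gs ! w"
proof (induction gs' rule: rev_induct)
  case (snoc g gs')
  then show ?case
    using assms by (simp add: nth_append length_foldl_snoc)
qed simp

definition wf_gates :: "nat \<Rightarrow> gate list \<Rightarrow> bool" where
  "wf_gates n gs \<longleftrightarrow> (\<forall>k<length gs. \<forall>i\<in>gate_inputs (gs ! k). i < n + k)"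

lemma wf_gates_snoc:
  "wf_gates n (gs @ [g]) \<longleftrightarrow> wf_gates n gs \<and> (\<forall>i\<in>gate_inputs g. i < n + length gs)"
  by (auto simp: wf_gates_def nth_append less_Suc_eq)

text \<open>The invariant of a construction that only appends gates. Depth is an upper bound, so
  that wires of different depths can be brought to a common \<open>D\<close> before they feed a
  gate.\<close>

definition available :: "nat \<Rightarrow> gate list \<Rightarrow> nat \<Rightarrow> nat \<Rightarrow> (bit list \<Rightarrow> bit) \<Rightarrow> bool" where
  "available n gs w D h \<longleftrightarrow> w < n + length gs \<and> wire_depths (replicate n 0) gs ! w \<le> D \<and>
     (\<forall>xs\<in>cube n. wire_values xs gs ! w = h xs)"

lemma available_append:
  assumes "available n gs w D h"
  shows "available n (gs @ gs') w D h"
  using assms foldl_snoc_append_nth[of w "replicate n 0" gs _ gs']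
  by (auto simp: available_def cube_def foldl_snoc_append_nth simp del: foldl_append)

lemma available_mono: "available n gs w D h \<Longrightarrow> D \<le> E \<Longrightarrow> available n gs w E h"
  by (auto simp: available_def)

lemma available_input: "i < n \<Longrightarrow> available n [] i 0 (\<lambda>xs. xs ! i)"
  by (simp add: available_def)

lemma available_gate:
  assumes "\<And>i. i \<in> gate_inputs g \<Longrightarrow> i < n + length gs \<and> wire_depths (replicate n 0) gs ! i \<le> D"
    and "\<And>xs. xs \<in> cube n \<Longrightarrow> gate_value (wire_values xs gs) g = h xs"
  shows "available n (gs @ [g]) (n + length gs) (Suc D) h"
proof -
  have "Max ((!) (wire_depths (replicate n 0) gs) ` gate_inputs g) \<le> D"
    using assms(1) by (cases g) auto
  moreover have "(wire_values xs gs @ [b]) ! (n + length gs) = b" if "xs \<in> cube n" for xs b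
    using that by (simp add: nth_append length_foldl_snoc cube_def)
  ultimately show ?thesis
    using assms(2) by (simp add: available_def nth_append length_foldl_snoc)
qed

lemma available_not:
  assumes "available n gs w D h"
  shows "available n (gs @ [Not_Gate w]) (n + length gs) (Suc D) (\<lambda>xs. 1 + h xs)"
  by (rule available_gate) (use assms in \<open>auto simp: available_def\<close>)

lemma available_and:
  assumes "available n gs w D h" "available n gs w' D h'"
  shows "available n (gs @ [And_Gate w w']) (n + length gs) (Suc D) (\<lambda>xs. h xs * h' xs)"
  by (rule available_gate) (use assms in \<open>auto simp: available_def\<close>)

lemma available_or:
  assumes "available n gs w D h" "available n gs w' D h'"
  shows "available n (gs @ [Or_Gate w w']) (n + length gs) (Suc D)
    (\<lambda>xs. h xs + h' xs + h xs * h' xs)"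
  by (rule available_gate) (use assms in \<open>auto simp: available_def\<close>)

lemma available_less: "available n gs w D h \<Longrightarrow> w < n + length gs"
  by (simp add: available_def)

lemma available_cong:
  "available n gs w D h \<Longrightarrow> (\<And>xs. xs \<in> cube n \<Longrightarrow> h xs = h' xs) \<Longrightarrow> available n gs w D h'"
  by (simp add: available_def)

definition extension :: "nat \<Rightarrow> nat \<Rightarrow> gate list \<Rightarrow> gate list \<Rightarrow> bool" where
  "extension n K gs gs' \<longleftrightarrow> wf_gates n gs' \<and> (\<exists>hs. gs' = gs @ hs \<and> length hs \<le> K)"

lemma extension_refl: "wf_gates n gs \<Longrightarrow> extension n 0 gs gs"
  by (simp add: extension_def)

lemma extension_trans:
  "extension n K gs gs' \<Longrightarrow> extension n L gs' gs'' \<Longrightarrow> extension n (K + L) gs gs''"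
  by (auto simp: extension_def)

lemma extension_wf: "extension n K gs gs' \<Longrightarrow> wf_gates n gs'"
  by (simp add: extension_def)

lemma extension_mono: "extension n K gs gs' \<Longrightarrow> K \<le> L \<Longrightarrow> extension n L gs gs'"
  by (auto simp: extension_def)

lemma extension_available:
  "extension n K gs gs' \<Longrightarrow> available n gs w D h \<Longrightarrow> available n gs' w D h"
  by (auto simp: extension_def available_append)

lemma extension_snoc:
  "wf_gates n gs \<Longrightarrow> (\<And>i. i \<in> gate_inputs g \<Longrightarrow> i < n + length gs) \<Longrightarrow>
    extension n 1 gs (gs @ [g])"
  by (auto simp: extension_def wf_gates_snoc)

section \<open>Constant-cost gadgets for functions of fixed arity\<close>

definition compilable :: "nat \<Rightarrow> (bit list \<Rightarrow> bit) \<Rightarrow> nat \<Rightarrow> bool" where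
  \<comment> \<open>The single constant \<open>K\<close> bounds both the added gates and the added
    depth, uniformly in the surrounding list and the wires fed in. The condition
    \<open>n \<ge> 1\<close> guarantees an input wire from which constants can be made.\<close>
  "compilable d F K \<longleftrightarrow> (\<forall>n gs ws D hs. n \<ge> 1 \<longrightarrow> wf_gates n gs \<longrightarrow>
     (\<forall>j<d. available n gs (ws j) D (hs j)) \<longrightarrow>
     (\<exists>gs' w. extension n K gs gs' \<and>
        available n gs' w (D + K) (\<lambda>xs. F (map (\<lambda>j. hs j xs) [0..<d]))))"

lemma compilableE:
  assumes "compilable d F K" "n \<ge> 1" "wf_gates n gs" "\<forall>j<d. available n gs (ws j) D (hs j)"
  obtains gs' w where "extension n K gs gs'"
    "available n gs' w (D + K) (\<lambda>xs. F (map (\<lambda>j. hs j xs) [0..<d]))"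
  using assms(1)[unfolded compilable_def, THEN spec, THEN spec, THEN spec, THEN spec, THEN spec,
      THEN mp, OF assms(2), THEN mp, OF assms(3), THEN mp, OF assms(4)] that
  by (elim exE conjE)

lemma extend_not:
  assumes "wf_gates n gs" "available n gs w D h"
  obtains gs' w' where "extension n 1 gs gs'" "available n gs' w' (Suc D) (\<lambda>xs. 1 + h xs)"
  using assms available_not[OF assms(2)] extension_snoc[of n gs "Not_Gate w"]
  by (auto simp: available_less)

lemma extend_and:
  assumes "wf_gates n gs" "available n gs w D h" "available n gs v D k"
  obtains gs' w' where "extension n 1 gs gs'" "available n gs' w' (Suc D) (\<lambda>xs. h xs * k xs)"
proof (rule that)
  show "extension n 1 gs (gs @ [And_Gate w v])"
    using assms by (intro extension_snoc) (auto dest: available_less)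
qed (rule available_and[OF assms(2,3)])

lemma extend_or:
  assumes "wf_gates n gs" "available n gs w D h" "available n gs v D k"
  obtains gs' w' where "extension n 1 gs gs'"
    "available n gs' w' (Suc D) (\<lambda>xs. h xs + k xs + h xs * k xs)"
proof (rule that)
  show "extension n 1 gs (gs @ [Or_Gate w v])"
    using assms by (intro extension_snoc) (auto dest: available_less)
qed (rule available_or[OF assms(2,3)])

text \<open>Gates always read a wire, so constants come from the first input:
  \<open>x \<and> \<not> x\<close> is 0, and its negation is 1. This takes three gates.\<close>

lemma compilable_nullary: "compilable 0 F 3"
  unfolding compilable_def
proof (intro allI impI)
  fix n D :: nat and gs :: "gate list" and ws :: "nat \<Rightarrow> nat" and hs :: "nat \<Rightarrow> bit list \<Rightarrow> bit"
  assume n: "n \<ge> 1" and wf: "wf_gates n gs"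
  have "available n ([] @ gs) 0 D (\<lambda>xs. xs ! 0)"
    by (rule available_append, rule available_mono, rule available_input) (use n in auto)
  then have in0: "available n gs 0 D (\<lambda>xs. xs ! 0)" by simp
  obtain gs1 w1 where 1: "extension n 1 gs gs1" "available n gs1 w1 (Suc D) (\<lambda>xs. 1 + xs ! 0)"
    using extend_not[OF wf in0] by blast
  obtain gs2 w2 where 2: "extension n 1 gs1 gs2"
    "available n gs2 w2 (Suc (Suc D)) (\<lambda>xs. xs ! 0 * (1 + xs ! 0))"
    using extend_and[OF extension_wf[OF 1(1)]
        available_mono[OF extension_available[OF 1(1) in0], of "Suc D"] 1(2)] by auto
  have "xs ! 0 * (1 + xs ! 0) = 0" for xs :: "bit list" by (cases "xs ! 0") auto
  then have zero: "available n gs2 w2 (Suc (Suc D)) (\<lambda>xs. 0)"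
    by (intro available_cong[OF 2(2)])
  obtain gs3 w3 where 3: "extension n 1 gs2 gs3"
    "available n gs3 w3 (Suc (Suc (Suc D))) (\<lambda>xs. 1)"
    using extend_not[OF extension_wf[OF 2(1)] zero] by auto
  have ext: "extension n 3 gs gs3"
    using extension_trans[OF 1(1) extension_trans[OF 2(1) 3(1)]] by (simp add: numeral_3_eq_3)
  have av: "available n gs3 w2 (D + 3) (\<lambda>xs. 0)" "available n gs3 w3 (D + 3) (\<lambda>xs. 1)"
    using available_mono[OF extension_available[OF 3(1) zero]] available_mono[OF 3(2)] by simp_all
  show "\<exists>gs' w. extension n 3 gs gs' \<and>
      available n gs' w (D + 3) (\<lambda>xs. F (map (\<lambda>j. hs j xs) [0..<0]))"
    using ext av by (cases "F []") auto
qed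

text \<open>Shannon expansion in the last variable \<open>x\<close>: \<open>F = x F(\<dots>, 1) \<or> \<not> x F(\<dots>, 0)\<close>.\<close>

lemma compilable_Suc:
  assumes "compilable d (\<lambda>ys. F (ys @ [1])) K" "compilable d (\<lambda>ys. F (ys @ [0])) L"
  shows "compilable (Suc d) F (K + L + 4)"
  unfolding compilable_def
proof (intro allI impI)
  fix n D :: nat and gs :: "gate list" and ws :: "nat \<Rightarrow> nat" and hs :: "nat \<Rightarrow> bit list \<Rightarrow> bit"
  assume n: "n \<ge> 1" and wf: "wf_gates n gs"
    and hyp: "\<forall>j<Suc d. available n gs (ws j) D (hs j)"
  let ?F = "\<lambda>b xs. F (map (\<lambda>j. hs j xs) [0..<d] @ [b])"
  obtain gs1 w1 where 1: "extension n K gs gs1" "available n gs1 w1 (D + K) (?F 1)"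
  proof (rule compilableE[OF assms(1) n wf])
    show "\<forall>j<d. available n gs (ws j) D (hs j)" using hyp by simp
  qed
  have "\<forall>j<d. available n gs1 (ws j) D (hs j)"
    using hyp extension_available[OF 1(1)] by simp
  then obtain gs2 w2 where 2: "extension n L gs1 gs2" "available n gs2 w2 (D + L) (?F 0)"
    by (rule compilableE[OF assms(2) n extension_wf[OF 1(1)]])
  \<comment> \<open>Both cofactors now sit in one list. The four remaining gates are a negation, two
    conjunctions and a disjunction.\<close>
  let ?E = "D + K + L"
  have F1: "available n gs2 w1 ?E (?F 1)"
    using available_mono[OF extension_available[OF 2(1) 1(2)]] by simp
  have F0: "available n gs2 w2 (Suc ?E) (?F 0)" using available_mono[OF 2(2)] by simp
  have "available n gs2 (ws d) D (hs d)"
    by (intro extension_available[OF 2(1)] extension_available[OF 1(1)]) (use hyp in simp)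
  then have x: "available n gs2 (ws d) ?E (hs d)" by (rule available_mono) simp
  obtain gs3 w3 where 3: "extension n 1 gs2 gs3"
    "available n gs3 w3 (Suc ?E) (\<lambda>xs. 1 + hs d xs)"
    using extend_not[OF extension_wf[OF 2(1)] x] by auto
  obtain gs4 w4 where 4: "extension n 1 gs3 gs4"
    "available n gs4 w4 (Suc ?E) (\<lambda>xs. hs d xs * ?F 1 xs)"
    using extend_and[OF extension_wf[OF 3(1)] extension_available[OF 3(1) x]
        extension_available[OF 3(1) F1]] by auto
  obtain gs5 w5 where 5: "extension n 1 gs4 gs5"
    "available n gs5 w5 (Suc (Suc ?E)) (\<lambda>xs. (1 + hs d xs) * ?F 0 xs)"
    using extend_and[OF extension_wf[OF 4(1)] extension_available[OF 4(1) 3(2)]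
        extension_available[OF 4(1) extension_available[OF 3(1) F0]]] by auto
  obtain gs6 w6 where 6: "extension n 1 gs5 gs6"
    "available n gs6 w6 (Suc (Suc (Suc ?E))) (\<lambda>xs. hs d xs * ?F 1 xs + (1 + hs d xs) * ?F 0 xs
        + (hs d xs * ?F 1 xs) * ((1 + hs d xs) * ?F 0 xs))"
    using extend_or[OF extension_wf[OF 5(1)]
        available_mono[OF extension_available[OF 5(1) 4(2)], of "Suc (Suc ?E)"] 5(2)] by auto
  have "extension n (K + L + 4) gs gs6"
    using extension_trans[OF extension_trans[OF extension_trans[OF extension_trans[OF
          extension_trans[OF 1(1) 2(1)] 3(1)] 4(1)] 5(1)] 6(1)] by (simp add: eval_nat_numeral)
  moreover have "available n gs6 w6 (D + (K + L + 4)) (\<lambda>xs. F (map (\<lambda>j. hs j xs) [0..<Suc d]))"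
  proof (rule available_cong)
    fix xs
    show "hs d xs * ?F 1 xs + (1 + hs d xs) * ?F 0 xs
        + (hs d xs * ?F 1 xs) * ((1 + hs d xs) * ?F 0 xs) = F (map (\<lambda>j. hs j xs) [0..<Suc d])"
      \<comment> \<open>For either value of the last variable one of the two conjunctions is 0, so
        the product term of the disjunction vanishes and the matching cofactor remains.\<close>
      by (cases "hs d xs") auto
  qed (rule available_mono[OF 6(2)], simp)
  ultimately show "\<exists>gs' w. extension n (K + L + 4) gs gs' \<and> available n gs' w (D + (K + L + 4))
      (\<lambda>xs. F (map (\<lambda>j. hs j xs) [0..<Suc d]))" by blast
qed

text \<open>Shannon expansion down to arity 0. The resulting \<open>K\<close> grows exponentially
  with \<open>d\<close>, but it is fixed before the number \<open>n\<close> of circuit inputs, as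
  the asymptotic bounds require.\<close>

lemma compilable_exists: "\<exists>K. compilable d F K"
proof (induction d arbitrary: F)
  case 0
  then show ?case using compilable_nullary by blast
next
  case (Suc d)
  then show ?case using compilable_Suc by blast
qed

section \<open>Trees of gadgets\<close>

lemma iterate_extension:
  assumes "wf_gates n gs"
    and step: "\<And>j gs. j < k \<Longrightarrow> wf_gates n gs \<Longrightarrow>
      \<exists>gs' w. extension n L gs gs' \<and> available n gs' w D (h j)"
  shows "\<exists>gs' ws. extension n (k * L) gs gs' \<and> (\<forall>j<k. available n gs' (ws j) D (h j))"
  using step
proof (induction k)
  case 0
  then show ?case using extension_refl[OF assms(1)] by auto
next
  case (Suc k)
  from Suc.IH[OF Suc.prems] obtain gs1 ws where
    1: "extension n (k * L) gs gs1" "\<forall>j<k. available n gs1 (ws j) D (h j)" by auto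
  obtain gs2 w where 2: "extension n L gs1 gs2" "available n gs2 w D (h k)"
    using Suc.prems[of k gs1] extension_wf[OF 1(1)] by auto
  have "\<forall>j<Suc k. available n gs2 ((ws(k := w)) j) D (h j)"
    using 1(2) 2 extension_available[OF 2(1)] by (auto simp: less_Suc_eq)
  moreover have "extension n (Suc k * L) gs gs2"
    using extension_trans[OF 1(1) 2(1)] by (simp add: add.commute)
  ultimately show ?case by blast
qed

text \<open>A full \<open>d\<close>-ary tree with \<open>d ^ i\<close> leaves has fewer than \<open>d ^ i\<close> internal nodes.\<close>

lemma compile_iter_comp:
  assumes K: "compilable d F K" and d: "2 \<le> d" and n: "1 \<le> n"
    and "wf_gates n gs" "a + d ^ i \<le> n"
  shows "\<exists>gs' w. extension n (K * (d ^ i - 1)) gs gs' \<and>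
    available n gs' w (K * i) (\<lambda>xs. iter_comp d F i (take (d ^ i) (drop a xs)))"
  using assms(4,5)
proof (induction i arbitrary: a gs)
  case 0
  have "available n ([] @ gs) a 0 (\<lambda>xs. xs ! a)"
    by (rule available_append, rule available_input) (use 0 in simp)
  then have "available n gs a 0 (\<lambda>xs. take 1 (drop a xs) ! 0)"
    using 0 by (auto simp: available_def cube_def)
  then show ?case using extension_refl[OF 0(1)] by auto
next
  case (Suc i)
  let ?L = "K * (d ^ i - 1)"
  let ?h = "\<lambda>j xs. iter_comp d F i (take (d ^ i) (drop (a + j * d ^ i) xs))"
  \<comment> \<open>Gate counts add up over the \<open>d\<close> subtrees, while the depth bound
    \<open>K * i\<close> is common to all of them. The offset \<open>a\<close> is general in the
    induction because subtree \<open>j\<close> reads the block starting at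
    \<open>a + j * d ^ i\<close>.\<close>
  have "\<exists>gs' ws. extension n (d * ?L) gs gs' \<and> (\<forall>j<d. available n gs' (ws j) (K * i) (?h j))"
  proof (rule iterate_extension[OF Suc.prems(1)])
    fix j gs assume "j < d" "wf_gates n gs"
    then show "\<exists>gs' w. extension n ?L gs gs' \<and> available n gs' w (K * i) (?h j)"
      using block_le[of j d "d ^ i"] Suc.prems(2) by (intro Suc.IH) auto
  qed
  then obtain gs1 ws where 1: "extension n (d * ?L) gs gs1"
    "\<forall>j<d. available n gs1 (ws j) (K * i) (?h j)" by blast
  obtain gs2 w where 2: "extension n K gs1 gs2"
    "available n gs2 w (K * i + K) (\<lambda>xs. F (map (\<lambda>j. ?h j xs) [0..<d]))"
    by (rule compilableE[OF K n extension_wf[OF 1(1)] 1(2)])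
  \<comment> \<open>The internal nodes of \<open>d\<close> subtrees plus the root fit into
    \<open>d ^ Suc i - 1\<close>; this is where \<open>2 \<le> d\<close> enters.\<close>
  have "d * (d ^ i - 1) = d ^ Suc i - d" by (simp add: diff_mult_distrib2)
  moreover have "d \<le> d ^ Suc i" using d by simp
  ultimately have "d * (d ^ i - 1) + 1 \<le> d ^ Suc i - 1" using d by linarith
  then have "K * (d * (d ^ i - 1) + 1) \<le> K * (d ^ Suc i - 1)" by (rule mult_le_mono2)
  then have "d * ?L + K \<le> K * (d ^ Suc i - 1)" by (simp add: algebra_simps)
  then have ext: "extension n (K * (d ^ Suc i - 1)) gs gs2"
    using extension_mono[OF extension_trans[OF 1(1) 2(1)]] by blast
  have "available n gs2 w (K * Suc i)
      (\<lambda>xs. iter_comp d F (Suc i) (take (d ^ Suc i) (drop a xs)))"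
  proof (rule available_cong)
    show "available n gs2 w (K * Suc i) (\<lambda>xs. F (map (\<lambda>j. ?h j xs) [0..<d]))"
      using 2(2) by (simp add: add.commute)
    fix xs assume xs: "xs \<in> cube n"
    have "iter_comp d F (Suc i) (take (d ^ Suc i) (drop a xs)) =
        F (map (\<lambda>j. iter_comp d F i
          (take (d ^ i) (drop (j * d ^ i) (take (d ^ Suc i) (drop a xs))))) [0..<d])"
      using xs Suc.prems(2) by (intro iter_comp_Suc) (auto simp: cube_def)
    also have "\<dots> = F (map (\<lambda>j. ?h j xs) [0..<d])"
    proof (intro arg_cong[where f = F] map_cong refl arg_cong[where f = "iter_comp d F i"])
      fix j assume "j \<in> set [0..<d]"
      then have "j * d ^ i + d ^ i \<le> d ^ Suc i" using block_le[of j d "d ^ i"] by simp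
      then show "take (d ^ i) (drop (j * d ^ i) (take (d ^ Suc i) (drop a xs))) =
          take (d ^ i) (drop (a + j * d ^ i) xs)"
        by (simp add: drop_take min_def add.commute)
    qed
    finally show "F (map (\<lambda>j. ?h j xs) [0..<d]) =
        iter_comp d F (Suc i) (take (d ^ Suc i) (drop a xs))" by simp
  qed
  with ext show ?case by blast
qed

text \<open>The sum over all bits is grouped into \<open>d\<close> consecutive blocks. The mask can
  thus be built by the same tree construction, with depth linear in \<open>i\<close> instead of
  linear in the number of bits.\<close>

lemma iter_comp_parity:
  "xs \<in> cube (d ^ i) \<Longrightarrow> iter_comp d (\<lambda>xs. \<Sum>j<d. xs ! j) i xs = (\<Sum>j<d ^ i. xs ! j)"
proof (induction i arbitrary: xs)
  case 0
  then show ?case by simp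
next
  case (Suc i)
  let ?m = "d ^ i"
  have len: "length xs = d * ?m" using Suc.prems by (simp add: cube_def)
  have "iter_comp d (\<lambda>xs. \<Sum>j<d. xs ! j) (Suc i) xs =
      (\<Sum>j<d. iter_comp d (\<lambda>xs. \<Sum>j<d. xs ! j) i (take ?m (drop (j * ?m) xs)))"
    using iter_comp_Suc[OF Suc.prems] by simp
  also have "\<dots> = (\<Sum>j<d. \<Sum>k<?m. xs ! (j * ?m + k))"
  proof (intro sum.cong refl)
    fix j assume "j \<in> {..<d}"
    then have j: "j * ?m + ?m \<le> length xs" using block_le[of j d ?m] len by simp
    then have "take ?m (drop (j * ?m) xs) \<in> cube ?m" by (simp add: cube_def)
    from Suc.IH[OF this]
    show "iter_comp d (\<lambda>xs. \<Sum>j<d. xs ! j) i (take ?m (drop (j * ?m) xs)) =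
        (\<Sum>k<?m. xs ! (j * ?m + k))"
      using j by simp
  qed
  also have "\<dots> = (\<Sum>j<d. sum ((!) xs) {j * ?m..<j * ?m + ?m})"
  proof (rule sum.cong[OF refl])
    fix j
    show "(\<Sum>k<?m. xs ! (j * ?m + k)) = sum ((!) xs) {j * ?m..<j * ?m + ?m}"
      using sum.shift_bounds_nat_ivl[of "(!) xs" 0 "j * ?m" ?m]
      by (simp add: lessThan_atLeast0 add.commute)
  qed
  also have "\<dots> = (\<Sum>j<d * ?m. xs ! j)" by (rule sum.nat_group)
  finally show ?case by simp
qed

lemma computes_masked:
  assumes d: "2 \<le> d" and K: "compilable d f K" "compilable d (\<lambda>xs. \<Sum>j<d. xs ! j) L"
    "compilable 2 (\<lambda>ys. ys ! 0 + ys ! 1) M"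
  shows "\<exists>C. computes (d ^ u) C (masked d f u) \<and> circuit_size C \<le> (K + L + M) * d ^ u \<and>
    circuit_depth (d ^ u) C \<le> (K + L) * u + M"
proof -
  let ?n = "d ^ u" and ?p = "\<lambda>xs. \<Sum>j<d. xs ! j :: bit"
  have n: "1 \<le> ?n" using d by simp
  have "wf_gates ?n []" by (simp add: wf_gates_def)
  from compile_iter_comp[OF K(1) d n this, of 0 u] obtain gs1 w1 where
    1: "extension ?n (K * (?n - 1)) [] gs1"
      "available ?n gs1 w1 (K * u) (\<lambda>xs. iter_comp d f u (take ?n xs))" by auto
  from compile_iter_comp[OF K(2) d n extension_wf[OF 1(1)], of 0 u] obtain gs2 w2 where
    2: "extension ?n (L * (?n - 1)) gs1 gs2"
      "available ?n gs2 w2 (L * u) (\<lambda>xs. iter_comp d ?p u (take ?n xs))" by auto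
  \<comment> \<open>The final exclusive-or is a gadget of arity 2, so the outputs of the two trees
    are packed into families indexed by \<open>j < 2\<close>, with the common depth bound
    \<open>(K + L) * u\<close>.\<close>
  let ?ws = "\<lambda>j. if j = 0 then w1 else w2"
  let ?hs = "\<lambda>j xs. if j = (0 :: nat) then iter_comp d f u (take ?n xs)
    else iter_comp d ?p u (take ?n xs)"
  have "\<forall>j<2. available ?n gs2 (?ws j) ((K + L) * u) (?hs j)"
    using available_mono[OF extension_available[OF 2(1) 1(2)]] available_mono[OF 2(2)]
    by (auto simp: distrib_right)
  then obtain gs3 w3 where 3: "extension ?n M gs2 gs3"
    "available ?n gs3 w3 ((K + L) * u + M)
      (\<lambda>xs. map (\<lambda>j. ?hs j xs) [0..<2] ! 0 + map (\<lambda>j. ?hs j xs) [0..<2] ! 1)"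
    by (rule compilableE[OF K(3) n extension_wf[OF 2(1)]])
  have av: "available ?n gs3 w3 ((K + L) * u + M) (masked d f u)"
    by (rule available_cong[OF 3(2)]) (auto simp: masked_def iter_comp_parity cube_def)
  have "extension ?n (K * (?n - 1) + (L * (?n - 1) + M)) [] gs3"
    by (rule extension_trans[OF 1(1) extension_trans[OF 2(1) 3(1)]])
  then have wf: "wf_gates ?n gs3" and len: "length gs3 \<le> K * (?n - 1) + (L * (?n - 1) + M)"
    by (auto simp: extension_def)
  \<comment> \<open>Since \<open>?n\<close> is at least 1, the constant cost \<open>M\<close> of the
    last gadget is absorbed into a multiple of \<open>?n\<close>.\<close>
  have "K * (?n - 1) \<le> K * ?n" "L * (?n - 1) \<le> L * ?n" "M \<le> M * ?n"
    using n by auto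
  with len have "length gs3 \<le> (K + L + M) * ?n" by (simp only: distrib_right)
  with wf av show ?thesis
    by (intro exI[of _ "Circuit gs3 w3"])
      (auto simp: computes_def wf_circuit_def wf_gates_def available_def circuit_value_def
        circuit_size_def circuit_depth_def)
qed

section \<open>Order of resilience and asymptotic circuit bounds\<close>

theorem mainTheorem4:
  fixes d p :: nat and f :: "bit list \<Rightarrow> bit"
  assumes "2 \<le> d"
    and "pdeg d f = p"
    and "p < d"
  shows
    "(\<forall>u\<ge>1. \<exists>m::nat.
        real m = real (d ^ u) - pow_log_ratio (d ^ u) p d - 1 \<and>
        resilient m (d ^ u) (masked d f u)) \<and>
     (\<exists>C :: nat \<Rightarrow> circuit.
        (\<forall>u\<ge>1. computes (d ^ u) (C u) (masked d f u)) \<and>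
        (\<lambda>u. real (circuit_size (C u))) \<in> O(\<lambda>u. real (d ^ u)) \<and>
        (\<lambda>u. real (circuit_depth (d ^ u) (C u))) \<in> O(\<lambda>u. ln (real (d ^ u))))"
proof (intro conjI allI impI)
  fix u :: nat assume u: "u \<ge> 1"
  then have lt: "p ^ u < d ^ u" using assms(3) by (intro power_strict_mono) auto
  \<comment> \<open>Because \<open>p ^ u < d ^ u\<close>, both truncated subtractions are exact, so
    the claimed order is a natural number.\<close>
  have "real (d ^ u - p ^ u - 1) = real (d ^ u) - pow_log_ratio (d ^ u) p d - 1"
    using lt by (simp only: pow_log_ratio_eq[OF assms(1) u])
  moreover have "resilient (d ^ u - p ^ u - 1) (d ^ u) (masked d f u)"
    by (rule resilient_masked) (use lt assms(2) in simp)
  ultimately show "\<exists>m::nat. real m = real (d ^ u) - pow_log_ratio (d ^ u) p d - 1 \<and>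
      resilient m (d ^ u) (masked d f u)" by blast
next
  \<comment> \<open>The gadget constants are fixed before \<open>u\<close> varies: \<open>K\<close>
    for \<open>f\<close>, \<open>L\<close> for the parity of \<open>d\<close> bits, \<open>M\<close>
    for the final exclusive-or.\<close>
  obtain K L M where "compilable d f K" "compilable d (\<lambda>xs. \<Sum>j<d. xs ! j) L"
    "compilable 2 (\<lambda>ys. ys ! 0 + ys ! 1) M"
    using compilable_exists by meson
  from computes_masked[OF assms(1) this] obtain C where
    C: "\<And>u. computes (d ^ u) (C u) (masked d f u)"
      "\<And>u. circuit_size (C u) \<le> (K + L + M) * d ^ u"
      "\<And>u. circuit_depth (d ^ u) (C u) \<le> (K + L) * u + M"
    by metis
  have "(\<lambda>u. real (circuit_size (C u))) \<in> O(\<lambda>u. real (d ^ u))"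
  proof (rule bigoI)
    show "\<forall>\<^sub>F u in sequentially. norm (real (circuit_size (C u)))
        \<le> real (K + L + M) * norm (real (d ^ u))"
      using C(2) by (intro always_eventually allI)
        (metis of_nat_le_iff of_nat_mult norm_of_nat)
  qed
  moreover have "(\<lambda>u. real (circuit_depth (d ^ u) (C u))) \<in> O(\<lambda>u. ln (real (d ^ u)))"
  proof (rule bigoI)
    \<comment> \<open>As \<open>ln (d ^ u) = u * ln d\<close>, a depth linear in \<open>u\<close> is
      logarithmic in the number of inputs, at the price of a factor \<open>1 / ln d\<close>. The
      estimate starts at \<open>u = 1\<close>, where \<open>M \<le> M * u\<close> holds.\<close>
    have ln: "ln (real d) > 0" using assms(1) by simp
    show "\<forall>\<^sub>F u in sequentially. norm (real (circuit_depth (d ^ u) (C u)))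
        \<le> (real (K + L + M) / ln (real d)) * norm (ln (real (d ^ u)))"
    proof (rule eventually_sequentiallyI)
      fix u :: nat assume u: "1 \<le> u"
      then have "M \<le> M * u" by simp
      with C(3)[of u] have "circuit_depth (d ^ u) (C u) \<le> (K + L + M) * u"
        by (simp only: distrib_right)
      then have "real (circuit_depth (d ^ u) (C u)) \<le> real (K + L + M) * real u"
        by (metis of_nat_le_iff of_nat_mult)
      then show "norm (real (circuit_depth (d ^ u) (C u)))
          \<le> (real (K + L + M) / ln (real d)) * norm (ln (real (d ^ u)))"
        using ln assms(1) by (simp add: ln_realpow)
    qed
  qed
  ultimately show "\<exists>C :: nat \<Rightarrow> circuit.
        (\<forall>u\<ge>1. computes (d ^ u) (C u) (masked d f u)) \<and>
        (\<lambda>u. real (circuit_size (C u))) \<in> O(\<lambda>u. real (d ^ u)) \<and>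
        (\<lambda>u. real (circuit_depth (d ^ u) (C u))) \<in> O(\<lambda>u. ln (real (d ^ u)))"
    using C(1) by blast
qed

end
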